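(* Let $\beta_1,\beta_2,\dots$ be an admissible enumeration of $\mathbb{Q}/\mathbb{Z}$. Then $\{(f_{\beta_n},\mathcal{B}_n):n=1,2,\dots\}$ is a sequence of martingale differences on $\mathbb{R}/\mathbb{Z}$ with normalized Haar measure. That is: - each $f_{\beta_n}$ is $\mathcal{B}_n$-measurable; - $\mathcal{B}_1\subseteq\mathcal{B}_2\subseteq\cdots$; - for every $n\ge1$ the conditional expectation of $f_{\beta_{n+1}}$ given $\mathcal{B}_n$ is $0$ almost everywhere. Equivalently, $\int_Jf_{\beta_{n+1}}(x)\,dx=0$ for every connected component $J$ of $\mathbb{R}/\mathbb{Z}\setminus\{\beta_1,\dots,\beta_n\}$.
   Context: Every $\beta\in\mathbb{Q}/\mathbb{Z}$ can be written $\beta=a/q$ with $q\ge1$ and $\gcd(a,q)=1$; its height is $h(\beta)=q$. Put $\mathcal{F}_Q=\{\beta:h(\beta)\le Q\}$. For distinct $a,b\in\mathbb{R}/\mathbb{Z}$, $I(a,b)$ is the open arc from $a$ to $b$ in the positive direction, i.e. $\{a+t\bmod1:0<t<d\}$ with $d\in(0,1)$, $d\equiv b-a\pmod1$. For $\beta\ne0$ with $h(\beta)=Q$: $\beta'$ is the unique point of $\mathcal{F}_Q$ with $I(\beta',\beta)\cap\mathcal{F}_Q=\emptyset$, and $\beta''$ is the unique point of $\mathcal{F}_Q$ with $I(\beta,\beta'')\cap\mathcal{F}_Q=\emptyset$. Let $\psi(x)=x-[x]-\frac12$ for $x\notin\mathbb{Z}$ and $\psi(x)=0$ for $x\in\mathbb{Z}$.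 Define $f_0\equiv1$ and, for $\beta\ne0$, $f_\beta(x)=h(\beta)\psi(x-\beta)-h(\beta')\psi(x-\beta')-h(\beta'')\psi(x-\beta'')$. An enumeration (a bijection $n\mapsto\beta_n$ from the positive integers onto $\mathbb{Q}/\mathbb{Z}$) is admissible if all three of the following hold: (i) $\beta_1=0$; (ii) whenever $m\ge2$ and $\beta_k=\beta_m'$, we have $k<m$; (iii) whenever $m\ge2$ and $\beta_l=\beta_m''$, we have $l<m$. $\mathcal{B}_n$ is the $\sigma$-algebra generated by the connected components of $\mathbb{R}/\mathbb{Z}\setminus\{\beta_1,\dots,\beta_n\}$ together with the singletons $\{\beta_1\},\dots,\{\beta_n\}$. *)

theory Defs
  imports "HOL-Probability.Probability"
begin

section \<open>The circle group \<open>\<real>/\<int>\<close>\<close>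

quotient_type circle = real / "\<lambda>x y. x - y \<in> \<int>"
proof (rule equivpI)
  show "reflp (\<lambda>x y::real. x - y \<in> \<int>)"
    by (simp add: reflp_def)
  show "symp (\<lambda>x y::real. x - y \<in> \<int>)"
    by (auto simp: symp_def dest: Ints_minus)
  show "transp (\<lambda>x y::real. x - y \<in> \<int>)"
    unfolding transp_def using Ints_add by fastforce
qed

lift_definition to_circle :: "real \<Rightarrow> circle" is "\<lambda>x. x" .

instantiation circle :: ab_group_add
begin

lift_definition zero_circle :: circle is 0 .

lift_definition plus_circle :: "circle \<Rightarrow> circle \<Rightarrow> circle" is "(+)"
  by (simp only: add_diff_add Ints_add)

lift_definition uminus_circle :: "circle \<Rightarrow> circle" is uminus
  using Ints_minus by fastforce

lift_definition minus_circle :: "circle \<Rightarrow> circle \<Rightarrow> circle" is "(-)"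
proof -
  fix a b c d :: real
  assume "a - b \<in> \<int>" "c - d \<in> \<int>"
  then have "(a - b) - (c - d) \<in> \<int>" by (rule Ints_diff)
  then show "a - c - (b - d) \<in> \<int>" by (simp add: algebra_simps)
qed

instance
  by standard (transfer; simp)+

end

instantiation circle :: topological_space
begin

text \<open>The quotient topology.\<close>

definition open_circle :: "circle set \<Rightarrow> bool" where
  "open_circle U \<longleftrightarrow> open (to_circle -` U)"

instance
  by standard (auto simp: open_circle_def vimage_Union)

end

lemma to_circle_eq_iff: "to_circle x = to_circle y \<longleftrightarrow> x - y \<in> \<int>"
  by transfer simp

lemma to_circle_add: "to_circle (x + y) = to_circle x + to_circle y"
  by transfer simp

lemma to_circle_surj: "\<exists>x. c = to_circle x"
proof transfer
  fix c :: real
  show "\<exists>x. c - x \<in> \<int>" by (rule exI[of _ c]) simp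
qed

lemma continuous_to_circle: "continuous_on UNIV to_circle"
  by (simp add: continuous_on_open_vimage open_circle_def)

lemma measurable_to_circle [measurable]: "to_circle \<in> borel_measurable borel"
  by (rule borel_measurable_continuous_onI[OF continuous_to_circle])

text \<open>Normalized Haar measure, as the image of Lebesgue measure on a fundamental domain; the
  two lemmas below are the properties that characterize it.\<close>

definition haar :: "circle measure" where
  "haar = distr (restrict_space lborel {0..<1}) borel to_circle"

lemma prob_space_haar: "prob_space haar"
proof -
  have "prob_space (restrict_space lborel {0..<1::real})"
    by (rule prob_spaceI) (simp add: emeasure_restrict_space space_restrict_space)
  moreover have "to_circle \<in> measurable (restrict_space lborel {0..<1}) borel"
    by (intro measurable_restrict_space1) simp
  ultimately show ?thesis
    unfolding haar_def by (rule prob_space.prob_space_distr)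
qed

lemma emeasure_haar:
  assumes "A \<in> sets borel"
  shows "emeasure haar A = emeasure lborel (to_circle -` A \<inter> {0..<1})"
proof -
  have [measurable]: "to_circle -` A \<in> sets borel"
    using measurable_sets[OF measurable_to_circle assms] by simp
  show ?thesis
    unfolding haar_def using assms
    by (subst emeasure_distr)
       (auto simp: emeasure_restrict_space space_restrict_space intro!: measurable_restrict_space1)
qed

lemma haar_translation_invariant: "distr haar borel (\<lambda>x. c + x) = haar"
proof (rule measure_eqI)
  show "sets (distr haar borel (\<lambda>x. c + x)) = sets haar"
    by (simp add: haar_def)
next
  fix A assume "A \<in> sets (distr haar borel (\<lambda>x. c + x))"
  then have A: "A \<in> sets borel" by simp
  obtain s0 where s0: "c = to_circle s0" using to_circle_surj by blast
  define s where "s = frac s0"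
  have s: "0 \<le> s" "s < 1" by (auto simp: s_def frac_lt_1)
  have cs: "c = to_circle s"
    unfolding s0 s_def to_circle_eq_iff by (simp add: frac_def)
  have shift_open: "open ((\<lambda>x. c + x) -` U)" if "open U" for U :: "circle set"
  proof -
    have "to_circle -` ((\<lambda>x. c + x) -` U) = (\<lambda>x. s + x) -` (to_circle -` U)"
      by (auto simp: cs to_circle_add)
    moreover have "open ((\<lambda>x. s + x) -` (to_circle -` U))"
      using that unfolding open_circle_def by (rule open_vimage) (intro continuous_intros)
    ultimately show ?thesis by (simp add: open_circle_def)
  qed
  have meas: "(\<lambda>x. c + x) \<in> measurable borel borel"
    by (rule borel_measurableI) (simp add: shift_open)
  have measc: "(\<lambda>x. c + x) -` A \<in> sets borel"
    using measurable_sets[OF meas A] by simp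
  let ?B = "to_circle -` A"
  have B [measurable]: "?B \<in> sets borel"
    using measurable_sets[OF measurable_to_circle A] by simp
  have per: "x + 1 \<in> ?B \<longleftrightarrow> x \<in> ?B" for x
  proof -
    have "to_circle (x + 1) = to_circle x" by (simp add: to_circle_eq_iff)
    then show ?thesis by simp
  qed
  have tr: "emeasure lborel X = emeasure lborel ((\<lambda>x. t + x) -` X)" if "X \<in> sets borel" for X and t :: real
  proof -
    have "emeasure lborel X = emeasure (distr lborel borel ((+) t)) X"
      by (simp add: lborel_distr_plus)
    also have "\<dots> = emeasure lborel ((\<lambda>x. t + x) -` X)"
      using that by (subst emeasure_distr) auto
    finally show ?thesis .
  qed
  have sp: "space haar = UNIV" "sets haar = sets borel"
    by (auto simp: haar_def)
  have "emeasure (distr haar borel (\<lambda>x. c + x)) A = emeasure haar ((\<lambda>x. c + x) -` A)"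
    using A meas sp by (subst emeasure_distr) (auto simp: measurable_def)
  also have "\<dots> = emeasure lborel (to_circle -` ((\<lambda>x. c + x) -` A) \<inter> {0..<1})"
    by (rule emeasure_haar[OF measc])
  also have "to_circle -` ((\<lambda>x. c + x) -` A) \<inter> {0..<1} = (\<lambda>x. s + x) -` (?B \<inter> {s..<1+s})"
    by (auto simp: cs to_circle_add)
  also have "emeasure lborel \<dots> = emeasure lborel (?B \<inter> {s..<1+s})"
    by (rule tr[symmetric]) simp
  also have "?B \<inter> {s..<1+s} = (?B \<inter> {s..<1}) \<union> (?B \<inter> {1..<1+s})"
    using s by auto
  also have "emeasure lborel \<dots> = emeasure lborel (?B \<inter> {s..<1}) + emeasure lborel (?B \<inter> {1..<1+s})"
    by (intro plus_emeasure[symmetric]) auto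
  also have "emeasure lborel (?B \<inter> {1..<1+s}) = emeasure lborel ((\<lambda>x. 1 + x) -` (?B \<inter> {1..<1+s}))"
    by (rule tr) simp
  also have "(\<lambda>x. 1 + x) -` (?B \<inter> {1..<1+s}) = ?B \<inter> {0..<s}"
    using per by (auto simp: add.commute)
  also have "emeasure lborel (?B \<inter> {s..<1}) + emeasure lborel (?B \<inter> {0..<s})
      = emeasure lborel ((?B \<inter> {s..<1}) \<union> (?B \<inter> {0..<s}))"
    by (intro plus_emeasure) auto
  also have "(?B \<inter> {s..<1}) \<union> (?B \<inter> {0..<s}) = ?B \<inter> {0..<1}"
    using s by auto
  also have "emeasure lborel \<dots> = emeasure haar A"
    by (rule emeasure_haar[OF A, symmetric])
  finally show "emeasure (distr haar borel (\<lambda>x. c + x)) A = emeasure haar A" .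
qed


section \<open>Farey points and the functions \<open>f\<^sub>\<beta>\<close>\<close>

definition rat_circle :: "circle set" where
  "rat_circle = to_circle ` \<rat>"

text \<open>Meaningful only for \<open>\<beta> \<in> rat_circle\<close>.\<close>

definition height :: "circle \<Rightarrow> nat" where
  "height \<beta> = (THE q. q \<ge> 1 \<and>
     (\<exists>a::int. coprime a (int q) \<and> \<beta> = to_circle (of_int a / of_nat q)))"

definition farey :: "nat \<Rightarrow> circle set" where
  "farey Q = {\<beta> \<in> rat_circle. height \<beta> \<le> Q}"

text \<open>Meaningful only for \<open>a \<noteq> b\<close>; for \<open>a = b\<close> the set is empty, which is why distinctness is
  required explicitly in the definitions of the two neighbours below.\<close>

definition arc_between :: "circle \<Rightarrow> circle \<Rightarrow> circle set" where
  "arc_between a b =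
     {a + to_circle t | t d. 0 < d \<and> d < 1 \<and> to_circle d = b - a \<and> 0 < t \<and> t < d}"

definition left_nbr :: "circle \<Rightarrow> circle" where
  "left_nbr \<beta> = (THE \<gamma>. \<gamma> \<in> farey (height \<beta>) \<and> \<gamma> \<noteq> \<beta> \<and>
     arc_between \<gamma> \<beta> \<inter> farey (height \<beta>) = {})"

definition right_nbr :: "circle \<Rightarrow> circle" where
  "right_nbr \<beta> = (THE \<gamma>. \<gamma> \<in> farey (height \<beta>) \<and> \<gamma> \<noteq> \<beta> \<and>
     arc_between \<beta> \<gamma> \<inter> farey (height \<beta>) = {})"

lift_definition psi :: "circle \<Rightarrow> real" is
  "\<lambda>x. if x \<in> \<int> then 0 else x - of_int \<lfloor>x\<rfloor> - 1/2"
proof -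
  fix x y :: real
  assume "x - y \<in> \<int>"
  then obtain k where "x - y = of_int k" by (elim Ints_cases)
  then have x: "x = y + of_int k" by simp
  have "x \<in> \<int> \<longleftrightarrow> y \<in> \<int>"
    unfolding x by (metis Ints_add Ints_diff Ints_of_int add_diff_cancel_right')
  then show "(if x \<in> \<int> then 0 else x - of_int \<lfloor>x\<rfloor> - 1/2) =
      (if y \<in> \<int> then 0 else y - of_int \<lfloor>y\<rfloor> - 1/2)"
    by (simp add: x)
qed

definition farey_fun :: "circle \<Rightarrow> circle \<Rightarrow> real" where
  "farey_fun \<beta> x =
     (if \<beta> = 0 then 1
      else real (height \<beta>) * psi (x - \<beta>)
         - real (height (left_nbr \<beta>)) * psi (x - left_nbr \<beta>)
         - real (height (right_nbr \<beta>)) * psi (x - right_nbr \<beta>))"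


section \<open>Admissible enumerations and the associated filtration\<close>

text \<open>Enumerations are indexed by the positive integers; the value at \<open>0\<close> is irrelevant.\<close>

definition admissible :: "(nat \<Rightarrow> circle) \<Rightarrow> bool" where
  "admissible \<beta> \<longleftrightarrow>
     bij_betw \<beta> {1..} rat_circle \<and>
     \<beta> 1 = 0 \<and>
     (\<forall>m k. m \<ge> 2 \<and> k \<ge> 1 \<and> \<beta> k = left_nbr (\<beta> m) \<longrightarrow> k < m) \<and>
     (\<forall>m l. m \<ge> 2 \<and> l \<ge> 1 \<and> \<beta> l = right_nbr (\<beta> m) \<longrightarrow> l < m)"

definition filt :: "(nat \<Rightarrow> circle) \<Rightarrow> nat \<Rightarrow> circle measure" where
  "filt \<beta> n = sigma UNIV
     (components (UNIV - \<beta> ` {1..n}) \<union> {{\<beta> k} | k. k \<in> {1..n}})"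

end

theory Submission
  imports Defs
begin

text \<open>
  Write \<open>\<beta> \<noteq> 0\<close> as the mediant of its two Farey neighbours \<open>\<beta>' = p1/q1\<close> and \<open>\<beta>'' = p2/q2\<close>. Since
  numerators and denominators add, \<open>f\<^sub>\<beta>\<close> is, away from \<open>\<beta>'\<close>, \<open>\<beta>\<close>, \<open>\<beta>''\<close>, the step function with value
  \<open>q1\<close> on the arc from \<open>\<beta>'\<close> to \<open>\<beta>\<close> (of length \<open>1/(q1 (q1 + q2))\<close>), \<open>-q2\<close> on the arc from \<open>\<beta>\<close> to
  \<open>\<beta>''\<close> (of length \<open>1/(q2 (q1 + q2))\<close>), and \<open>0\<close> elsewhere; so its integral over the arc from \<open>\<beta>'\<close>
  to \<open>\<beta>''\<close> vanishes. Every other rational point of that arc has a larger height than \<open>\<beta>\<close>, so its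
  Farey neighbours do not enclose \<open>\<beta>\<close> and one of them lies in the arc as well; hence \<open>\<beta>\<close> is the
  first point of the arc in any admissible enumeration. Thus, just before \<open>\<beta>\<close> is added, every set
  of the \<open>\<sigma>\<close>-algebra either contains the arc or misses it, and the integral of \<open>f\<^sub>\<beta>\<close> over the set
  is \<open>0\<close>.
\<close>


section \<open>Topology of the circle\<close>

lemma to_circle_0: "to_circle 0 = 0"
  by transfer simp

lemma to_circle_diff: "to_circle (x - y) = to_circle x - to_circle y"
  by transfer simp

lemma to_circle_plus_1: "to_circle (x + 1) = to_circle x"
  by (simp add: to_circle_eq_iff)

lemma to_circle_lift:
  obtains x where "c = to_circle x" "s \<le> x" "x < s + 1"
proof -
  obtain y where y: "c = to_circle y" using to_circle_surj by blast
  have "c = to_circle (s + frac (y - s))"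
    unfolding y to_circle_eq_iff by (simp add: frac_def)
  then show ?thesis using that frac_lt_1[of "y - s"] by simp
qed

lemma to_circle_eq_imp_eq:
  assumes "to_circle x = to_circle y" "\<bar>x - y\<bar> < 1"
  shows "x = y"
proof -
  from assms(1) obtain k where k: "x - y = of_int k"
    by (auto simp: to_circle_eq_iff elim: Ints_cases)
  with assms(2) have "\<bar>of_int k :: real\<bar> < 1" by simp
  then have "k = 0" by linarith
  with k show ?thesis by simp
qed

lemma open_to_circle_image:
  assumes "open S"
  shows "open (to_circle ` S)"
proof -
  have "to_circle -` to_circle ` S = (\<Union>k::int. (+) (of_int k) ` S)"
  proof (intro set_eqI iffI)
    fix x assume "x \<in> to_circle -` to_circle ` S"
    then obtain y where "y \<in> S" "x - y \<in> \<int>" by (auto simp: to_circle_eq_iff)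
    then obtain k where "x = of_int k + y" by (metis Ints_cases diff_add_cancel)
    with \<open>y \<in> S\<close> show "x \<in> (\<Union>k::int. (+) (of_int k) ` S)" by auto
  next
    fix x assume "x \<in> (\<Union>k::int. (+) (of_int k) ` S)"
    then obtain k :: int and y where "y \<in> S" "x = of_int k + y" by auto
    then have "to_circle x = to_circle y" by (simp add: to_circle_eq_iff)
    with \<open>y \<in> S\<close> show "x \<in> to_circle -` to_circle ` S" by auto
  qed
  then show ?thesis
    using assms by (simp add: open_circle_def open_translation open_UN)
qed

definition circle_arc :: "real \<Rightarrow> real \<Rightarrow> circle set" where
  "circle_arc a b = to_circle ` {a<..<b}"

lemma open_circle_arc: "open (circle_arc a b)"
  by (simp add: circle_arc_def open_to_circle_image)

lemma connected_circle_arc: "connected (circle_arc a b)"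
  unfolding circle_arc_def
  by (rule connected_continuous_image) (auto intro: continuous_on_subset[OF continuous_to_circle])

lemma to_circle_in_circle_arc_iff:
  assumes "s \<le> a" "b \<le> s + 1" "s \<le> x" "x \<le> s + 1"
  shows "to_circle x \<in> circle_arc a b \<longleftrightarrow> a < x \<and> x < b"
proof
  assume "to_circle x \<in> circle_arc a b"
  then obtain y where y: "to_circle x = to_circle y" "a < y" "y < b" by (auto simp: circle_arc_def)
  have "x = y" by (rule to_circle_eq_imp_eq[OF y(1)]) (use y assms in linarith)
  with y show "a < x \<and> x < b" by simp
qed (auto simp: circle_arc_def)

lemma circle_arc_Un_opposite:
  assumes "a \<le> b" "b \<le> a + 1"
  shows "circle_arc a b \<union> circle_arc b (a + 1) = - {to_circle a, to_circle b}"
proof (rule set_eqI)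
  fix c
  obtain x where x: "c = to_circle x" "a \<le> x" "x < a + 1" by (rule to_circle_lift)
  have "c = to_circle y \<longleftrightarrow> x = y" if "a \<le> y" "y < a + 1" for y
    using x that to_circle_eq_imp_eq[of x y] by auto
  moreover have "c = to_circle (a + 1) \<longleftrightarrow> x = a"
    using x to_circle_eq_imp_eq[of x a] by (auto simp: to_circle_plus_1)
  ultimately show "c \<in> circle_arc a b \<union> circle_arc b (a + 1) \<longleftrightarrow> c \<in> - {to_circle a, to_circle b}"
    using x assms to_circle_in_circle_arc_iff[of a _ _ x] by (cases "b = a + 1") auto
qed

lemma circle_arc_Int_opposite:
  assumes "a \<le> b" "b \<le> a + 1"
  shows "circle_arc a b \<inter> circle_arc b (a + 1) = {}"
proof -
  have "c \<notin> circle_arc b (a + 1)" if "c \<in> circle_arc a b" for c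
  proof -
    obtain x where "c = to_circle x" "a \<le> x" "x < a + 1" by (rule to_circle_lift)
    with that assms show ?thesis using to_circle_in_circle_arc_iff[of a _ _ x] by auto
  qed
  then show ?thesis by blast
qed

lemma connected_subset_circle_arc_or_disjoint:
  assumes "connected J" "a \<le> b" "b \<le> a + 1" "to_circle a \<notin> J" "to_circle b \<notin> J"
  shows "J \<subseteq> circle_arc a b \<or> J \<inter> circle_arc a b = {}"
proof -
  have cover: "J \<subseteq> circle_arc a b \<union> circle_arc b (a + 1)"
    using assms by (auto simp: circle_arc_Un_opposite)
  have "circle_arc a b \<inter> J = {} \<or> circle_arc b (a + 1) \<inter> J = {}"
    by (rule connectedD[OF \<open>connected J\<close> open_circle_arc open_circle_arc _ cover])
      (use assms in \<open>simp add: circle_arc_Int_opposite\<close>)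
  with cover show ?thesis by blast
qed

instance circle :: t1_space
proof
  fix c d :: circle assume "c \<noteq> d"
  obtain x where "d = to_circle x" using to_circle_surj by blast
  then have "circle_arc x (x + 1) = - {d}"
    using circle_arc_Un_opposite[of x x] by (simp add: circle_arc_def)
  with \<open>c \<noteq> d\<close> open_circle_arc show "\<exists>U. open U \<and> c \<in> U \<and> d \<notin> U"
    by (metis Compl_iff singleton_iff)
qed

instance circle :: second_countable_topology
proof
  obtain B :: "real set set" where B: "countable B" "topological_basis B"
    using ex_countable_basis by blast
  have "topological_basis ((`) to_circle ` B)"
  proof (rule topological_basisI)
    show "open V" if "V \<in> (`) to_circle ` B" for V
      using that topological_basis_open[OF B(2)] by (auto intro: open_to_circle_image)
    fix U and c :: circle assume U: "open U" "c \<in> U"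
    obtain x where x: "c = to_circle x" using to_circle_surj by blast
    have "open (to_circle -` U)" "x \<in> to_circle -` U"
      using U x by (simp_all add: open_circle_def)
    then obtain V where "V \<in> B" "x \<in> V" "V \<subseteq> to_circle -` U"
      by (rule topological_basisE[OF B(2)])
    with x show "\<exists>V\<in>(`) to_circle ` B. c \<in> V \<and> V \<subseteq> U"
      by (intro bexI[of _ "to_circle ` V"]) auto
  qed
  with \<open>countable B\<close> show "\<exists>B :: circle set set. countable B \<and> open = generate_topology B"
    using topological_basis_imp_subbasis by blast
qed

lemma locally_connected_circle: "locally connected (UNIV :: circle set)"
proof -
  have surj: "range to_circle = UNIV" using to_circle_surj by blast
  have "locally connected (range to_circle)"
    by (rule locally_connected_quotient_image)
      (simp_all add: surj open_circle_def locally_connected_UNIV)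
  then show ?thesis by (simp add: surj)
qed

lemma open_circle_component:
  fixes U :: "circle set"
  assumes "open U" "J \<in> components U"
  shows "open J"
  using locally_connected_circle assms unfolding locally_connected_open_component by auto

lemma continuous_on_circle_plus: "continuous_on UNIV ((+) (c :: circle))"
proof -
  obtain s where s: "c = to_circle s" using to_circle_surj by blast
  have "open ((+) c -` U)" if "open U" for U
  proof -
    have "to_circle -` (+) c -` U = (+) s -` to_circle -` U"
      by (auto simp: s to_circle_add)
    moreover have "open ((+) s -` to_circle -` U)"
      using that unfolding open_circle_def by (rule open_vimage) (intro continuous_intros)
    ultimately show ?thesis by (simp add: open_circle_def)
  qed
  then show ?thesis by (simp add: continuous_on_open_vimage)
qed


section \<open>Haar measure of arcs\<close>

lemma sets_haar: "sets haar = sets borel"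
  by (simp add: haar_def)

lemma space_haar: "space haar = UNIV"
  by (simp add: haar_def)

lemma circle_arc_in_sets_haar: "circle_arc a b \<in> sets haar"
  by (simp add: sets_haar open_circle_arc)

lemma measurable_circle_plus: "(+) (c :: circle) \<in> borel_measurable borel"
  by (rule borel_measurable_continuous_onI[OF continuous_on_circle_plus])

lemma measure_haar_translate:
  assumes "A \<in> sets borel"
  shows "measure haar ((+) c -` A) = measure haar A"
proof -
  have "measure haar A = measure (distr haar borel ((+) c)) A"
    by (simp add: haar_translation_invariant)
  also have "\<dots> = measure haar ((+) c -` A \<inter> space haar)"
    using measurable_circle_plus assms
    by (intro measure_distr) (simp_all add: measurable_cong_sets[OF sets_haar refl])
  finally show ?thesis by (simp add: space_haar)
qed

lemma measure_haar_circle_arc: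
  assumes "a \<le> b" "b \<le> a + 1"
  shows "measure haar (circle_arc a b) = b - a"
proof -
  have "measure haar (circle_arc a b) = measure haar ((+) (to_circle a) -` circle_arc a b)"
    by (simp add: measure_haar_translate open_circle_arc)
  also have "(+) (to_circle a) -` circle_arc a b = circle_arc 0 (b - a)"
  proof (rule set_eqI)
    fix c
    obtain x where x: "c = to_circle x" "0 \<le> x" "x < 0 + 1" by (rule to_circle_lift)
    then show "c \<in> (+) (to_circle a) -` circle_arc a b \<longleftrightarrow> c \<in> circle_arc 0 (b - a)"
      using assms to_circle_in_circle_arc_iff[of a a b "a + x"]
        to_circle_in_circle_arc_iff[of 0 0 "b - a" x]
      by (auto simp: to_circle_add)
  qed
  also have "measure haar \<dots> = measure lborel (to_circle -` circle_arc 0 (b - a) \<inter> {0..<1})"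
    by (simp add: measure_def emeasure_haar open_circle_arc)
  also have "to_circle -` circle_arc 0 (b - a) \<inter> {0..<1} = {0<..<b - a}"
    using assms by (auto simp: to_circle_in_circle_arc_iff[of 0])
  finally show ?thesis using assms by simp
qed

lemma haar_singleton_null: "{c} \<in> null_sets haar"
proof -
  interpret prob_space haar by (rule prob_space_haar)
  have singleton: "{c} \<in> sets haar" by (simp add: sets_haar)
  obtain x where "c = to_circle x" using to_circle_surj by blast
  then have "circle_arc x (x + 1) = space haar - {c}"
    using circle_arc_Un_opposite[of x x] by (auto simp: circle_arc_def space_haar)
  then have "prob {c} = 0"
    using prob_compl[OF singleton] measure_haar_circle_arc[of x "x + 1"] by simp
  with singleton show ?thesis by (simp add: null_sets_def emeasure_eq_measure)
qed


section \<open>The sawtooth function on the circle\<close>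

lemma psi_to_circle:
  assumes "0 < t" "t < 1"
  shows "psi (to_circle t) = t - 1 / 2"
proof -
  have "\<lfloor>t\<rfloor> = 0" using assms by linarith
  moreover have "t \<notin> \<int>" using assms by (auto elim!: Ints_cases)
  ultimately show ?thesis by transfer auto
qed

lemma psi_0: "psi 0 = 0"
  by transfer simp

lemma abs_psi_le: "\<bar>psi c\<bar> \<le> 1 / 2"
proof -
  obtain t where t: "c = to_circle t" "0 \<le> t" "t < 0 + 1" by (rule to_circle_lift)
  then show ?thesis
    using psi_to_circle[of t] by (cases "t = 0") (auto simp: to_circle_0 psi_0 abs_if)
qed

lemma borel_measurable_psi: "psi \<in> borel_measurable borel"
proof (rule borel_measurable_continuous_countable_exceptions)
  have Compl_0: "- {0} = circle_arc 0 1"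
    using circle_arc_Un_opposite[of 0 0] by (simp add: circle_arc_def to_circle_0)
  have "psi -` V \<inter> circle_arc 0 1 = to_circle ` ((\<lambda>t. t - 1 / 2) -` V \<inter> {0<..<1})" for V
    by (auto simp: circle_arc_def psi_to_circle)
  moreover have "open ((\<lambda>t. t - 1 / 2 :: real) -` V)" if "open V" for V
    using that by (rule open_vimage) (intro continuous_intros)
  ultimately show "continuous_on (- {0}) psi"
    unfolding Compl_0 continuous_on_open_vimage[OF open_circle_arc]
    by (auto intro!: open_to_circle_image open_Int)
qed simp

lemma psi_diff:
  assumes "a \<le> b" "b \<le> a + 1" "c \<noteq> to_circle a" "c \<noteq> to_circle b"
  shows "psi (c - to_circle a) - psi (c - to_circle b) = (b - a) - indicator (circle_arc a b) c"
proof -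
  obtain x where x: "c = to_circle x" "a \<le> x" "x < a + 1" by (rule to_circle_lift)
  with assms have "a < x" "x \<noteq> b" by (auto simp: le_less)
  have "psi (c - to_circle a) = x - a - 1 / 2"
    using psi_to_circle[of "x - a"] x \<open>a < x\<close> by (simp add: to_circle_diff)
  moreover have "psi (c - to_circle b) = x - b + (if x < b then 1 / 2 else - 1 / 2)"
  proof (cases "x < b")
    case True
    have "c - to_circle b = to_circle (x - b + 1)"
      by (simp add: x to_circle_diff to_circle_plus_1)
    with True show ?thesis using psi_to_circle[of "x - b + 1"] x assms \<open>a < x\<close> by simp
  next
    case False
    with x assms \<open>x \<noteq> b\<close> show ?thesis
      using psi_to_circle[of "x - b"] by (simp add: to_circle_diff)
  qed
  moreover have "c \<in> circle_arc a b \<longleftrightarrow> x < b"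
    using x assms \<open>a < x\<close> to_circle_in_circle_arc_iff[of a a b x] by simp
  ultimately show ?thesis by simp
qed

lemma integrable_farey_fun: "integrable haar (farey_fun \<beta>)"
proof -
  interpret prob_space haar by (rule prob_space_haar)
  have "integrable haar (\<lambda>c. psi (c - \<gamma>))" for \<gamma>
  proof (rule integrable_const_bound)
    have "(\<lambda>c. psi (c - \<gamma>)) = psi \<circ> (+) (- \<gamma>)" by (simp add: fun_eq_iff)
    also have "\<dots> \<in> borel_measurable borel"
      by (rule measurable_comp[OF measurable_circle_plus borel_measurable_psi])
    finally show "(\<lambda>c. psi (c - \<gamma>)) \<in> borel_measurable haar"
      by (simp add: measurable_cong_sets[OF sets_haar refl])
    show "AE c in haar. norm (psi (c - \<gamma>)) \<le> 1 / 2"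
      using abs_psi_le by simp
  qed
  then show ?thesis by (cases "\<beta> = 0") (simp_all add: farey_fun_def[abs_def])
qed


section \<open>Farey neighbours on the circle\<close>

lemma arc_between_eq_circle_arc:
  assumes "a < b" "b < a + 1"
  shows "arc_between (to_circle a) (to_circle b) = circle_arc a b"
proof (intro set_eqI iffI)
  fix c assume "c \<in> arc_between (to_circle a) (to_circle b)"
  then obtain t d where td: "c = to_circle a + to_circle t" "0 < d" "d < 1"
    "to_circle d = to_circle b - to_circle a" "0 < t" "t < d"
    unfolding arc_between_def by blast
  then have "to_circle d = to_circle (b - a)" by (simp add: to_circle_diff)
  then have "d = b - a" by (rule to_circle_eq_imp_eq) (use assms td in linarith)
  with td show "c \<in> circle_arc a b"
    unfolding circle_arc_def by (intro image_eqI[of _ _ "a + t"]) (auto simp: to_circle_add)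
next
  fix c assume "c \<in> circle_arc a b"
  then obtain x where x: "c = to_circle x" "a < x" "x < b" by (auto simp: circle_arc_def)
  have "c = to_circle a + to_circle (x - a)" by (simp add: x to_circle_diff)
  moreover have "to_circle (b - a) = to_circle b - to_circle a" by (rule to_circle_diff)
  ultimately show "c \<in> arc_between (to_circle a) (to_circle b)"
    unfolding arc_between_def using x assms
    by (intro CollectI exI[of _ "x - a"] exI[of _ "b - a"]) auto
qed

lemma to_circle_lift_neq:
  assumes "c \<noteq> to_circle s"
  obtains x where "c = to_circle x" "s < x" "x < s + 1"
proof -
  obtain x where "c = to_circle x" "s \<le> x" "x < s + 1" by (rule to_circle_lift)
  with assms that show ?thesis by (metis order_le_less)
qed

lemma arc_between_cyclic:
  assumes "a \<noteq> b" "c \<in> arc_between a b"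
  shows "a \<in> arc_between b c"
proof -
  obtain x where x: "a = to_circle x" using to_circle_surj by blast
  with \<open>a \<noteq> b\<close> obtain y where y: "b = to_circle y" "x < y" "y < x + 1"
    using to_circle_lift_neq by metis
  with assms(2) obtain z where z: "c = to_circle z" "x < z" "z < y"
    by (auto simp: x arc_between_eq_circle_arc circle_arc_def)
  have "arc_between b c = circle_arc y (z + 1)"
    using arc_between_eq_circle_arc[of y "z + 1"] x y z by (simp add: to_circle_plus_1)
  moreover have "to_circle (x + 1) \<in> circle_arc y (z + 1)"
    unfolding circle_arc_def using y z by (intro imageI) simp
  ultimately show ?thesis by (simp add: x to_circle_plus_1)
qed

lemma arc_between_or_opposite:
  assumes "a \<noteq> b" "c \<noteq> a" "c \<noteq> b"
  shows "c \<in> arc_between a b \<or> c \<in> arc_between b a"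
proof -
  obtain x where x: "a = to_circle x" using to_circle_surj by blast
  with \<open>a \<noteq> b\<close> obtain y where y: "b = to_circle y" "x < y" "y < x + 1"
    using to_circle_lift_neq by metis
  have "c \<in> circle_arc x y \<union> circle_arc y (x + 1)"
    using assms x y by (simp add: circle_arc_Un_opposite)
  then show ?thesis
    using arc_between_eq_circle_arc[of x y] arc_between_eq_circle_arc[of y "x + 1"] x y
    by (auto simp: to_circle_plus_1)
qed

lemma arc_between_comparable:
  assumes "\<gamma> \<noteq> \<beta>" "\<delta> \<noteq> \<beta>" "\<gamma> \<noteq> \<delta>"
  shows "\<delta> \<in> arc_between \<gamma> \<beta> \<or> \<gamma> \<in> arc_between \<delta> \<beta>"
    and "\<delta> \<in> arc_between \<beta> \<gamma> \<or> \<gamma> \<in> arc_between \<beta> \<delta>"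
  using arc_between_or_opposite[of \<gamma> \<beta> \<delta>] arc_between_cyclic assms by metis+

lemma left_nbr_eqI:
  assumes "\<gamma> \<in> farey (height \<beta>)" "\<gamma> \<noteq> \<beta>" "arc_between \<gamma> \<beta> \<inter> farey (height \<beta>) = {}"
  shows "left_nbr \<beta> = \<gamma>"
  unfolding left_nbr_def
  by (rule the_equality) (use assms arc_between_comparable(1) in blast)+

lemma right_nbr_eqI:
  assumes "\<gamma> \<in> farey (height \<beta>)" "\<gamma> \<noteq> \<beta>" "arc_between \<beta> \<gamma> \<inter> farey (height \<beta>) = {}"
  shows "right_nbr \<beta> = \<gamma>"
  unfolding right_nbr_def
  by (rule the_equality) (use assms arc_between_comparable(2) in blast)+

lemma denominator_dvd_if_to_circle_eq:
  fixes a b q r :: int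
  assumes "q \<noteq> 0" "r \<noteq> 0" "coprime a q"
    and "to_circle (of_int a / of_int q) = to_circle (of_int b / of_int r)"
  shows "q dvd r"
proof -
  obtain k :: int where k: "of_int a / of_int q - of_int b / of_int r = (of_int k :: real)"
    using assms(4) by (auto simp: to_circle_eq_iff elim: Ints_cases)
  then have "real_of_int (a * r) = of_int (q * (b + k * r))"
    using assms(1,2) by (simp add: field_simps)
  then have "q dvd a * r" by (simp only: of_int_eq_iff dvd_triv_left)
  with \<open>coprime a q\<close> show ?thesis
    by (simp add: coprime_commute coprime_dvd_mult_right_iff)
qed

lemma height_to_circle:
  fixes a q :: int
  assumes "q > 0" "coprime a q"
  shows "height (to_circle (of_int a / of_int q)) = nat q"
  unfolding height_def
proof (rule the_equality)
  show "nat q \<ge> 1 \<and> (\<exists>b. coprime b (int (nat q)) \<and>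
      to_circle (of_int a / of_int q) = to_circle (of_int b / of_nat (nat q)))"
    using assms by (auto intro!: exI[of _ a])
next
  fix r assume "r \<ge> 1 \<and> (\<exists>b. coprime b (int r) \<and>
      to_circle (of_int a / of_int q) = to_circle (of_int b / of_nat r))"
  then obtain b where "r \<ge> 1" "coprime b (int r)"
    and eq: "to_circle (of_int a / of_int q) = to_circle (of_int b / of_int (int r))"
    by auto
  then have "q dvd int r" "int r dvd q"
    using denominator_dvd_if_to_circle_eq[OF _ _ _ eq]
      denominator_dvd_if_to_circle_eq[OF _ _ _ eq[symmetric]] assms by auto
  with \<open>q > 0\<close> show "r = nat q" using zdvd_antisym_nonneg[of q "int r"] by simp
qed

lemma height_0: "height 0 = 1"
  using height_to_circle[of 1 0] by (simp add: to_circle_0)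

lemma Rats_if_to_circle_in_rat_circle:
  assumes "to_circle x \<in> rat_circle"
  shows "x \<in> \<rat>"
proof -
  obtain y where "y \<in> \<rat>" "to_circle x = to_circle y"
    using assms by (auto simp: rat_circle_def)
  then have "x - y \<in> \<rat>" "y \<in> \<rat>" by (auto simp: to_circle_eq_iff elim!: Ints_cases)
  then show ?thesis by (metis Rats_add diff_add_cancel)
qed


section \<open>Farey pairs and their mediants\<close>

locale farey_pair =
  fixes p1 q1 p2 q2 :: int
  assumes q1_pos: "q1 > 0" and q2_pos: "q2 > 0"
    and det: "p2 * q1 - p1 * q2 = 1"
begin

definition lower :: real where "lower = of_int p1 / of_int q1"
definition mediant :: real where "mediant = of_int (p1 + p2) / of_int (q1 + q2)"
definition upper :: real where "upper = of_int p2 / of_int q2"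

lemma coprime_lower: "coprime p1 q1"
proof (rule coprimeI)
  fix d assume "d dvd p1" "d dvd q1"
  then have "d dvd p2 * q1 - p1 * q2" by (intro dvd_diff dvd_mult dvd_mult2)
  then show "d dvd 1" by (simp only: det)
qed

lemma coprime_upper: "coprime p2 q2"
proof (rule coprimeI)
  fix d assume "d dvd p2" "d dvd q2"
  then have "d dvd p2 * q1 - p1 * q2" by (intro dvd_diff dvd_mult dvd_mult2)
  then show "d dvd 1" by (simp only: det)
qed

lemma upper_minus_lower: "upper - lower = 1 / (of_int q1 * of_int q2)"
proof -
  have "real_of_int (p2 * q1 - p1 * q2) = 1" by (simp only: det of_int_1)
  then show ?thesis using q1_pos q2_pos by (simp add: lower_def upper_def field_simps)
qed

lemma lower_less_upper: "lower < upper"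
proof -
  have "0 < upper - lower" unfolding upper_minus_lower using q1_pos q2_pos by simp
  then show ?thesis by simp
qed

lemma height_lower: "height (to_circle lower) = nat q1"
  unfolding lower_def by (intro height_to_circle q1_pos coprime_lower)

lemma height_upper: "height (to_circle upper) = nat q2"
  unfolding upper_def by (intro height_to_circle q2_pos coprime_upper)

lemma sum_denominators_le:
  assumes "d > 0" "lower < of_int c / of_int d" "of_int c / of_int d < upper"
  shows "q1 + q2 \<le> d"
proof -
  have "real_of_int (p1 * d) < of_int (c * q1)"
    using assms(1,2) q1_pos by (simp add: lower_def field_simps)
  then have above: "1 \<le> c * q1 - p1 * d" by linarith
  have "real_of_int (c * q2) < of_int (p2 * d)"
    using assms(1,3) q2_pos by (simp add: upper_def field_simps)
  then have below: "1 \<le> p2 * d - c * q2" by linarith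
  have "q1 + q2 = 1 * q2 + 1 * q1" by simp
  also have "\<dots> \<le> (c * q1 - p1 * d) * q2 + (p2 * d - c * q2) * q1"
    using above below q1_pos q2_pos by (intro add_mono mult_right_mono) auto
  also have "\<dots> = d * (p2 * q1 - p1 * q2)" by (simp add: algebra_simps)
  finally show ?thesis by (simp add: det)
qed

interpretation lower_half: farey_pair p1 q1 "p1 + p2" "q1 + q2"
  rewrites "farey_pair.upper (p1 + p2) (q1 + q2) = mediant"
proof -
  show pair: "farey_pair p1 q1 (p1 + p2) (q1 + q2)"
    using q1_pos q2_pos det by unfold_locales (simp_all add: algebra_simps)
  show "farey_pair.upper (p1 + p2) (q1 + q2) = mediant"
    by (simp add: farey_pair.upper_def[OF pair] mediant_def)
qed

interpretation upper_half: farey_pair "p1 + p2" "q1 + q2" p2 q2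
  rewrites "farey_pair.lower (p1 + p2) (q1 + q2) = mediant"
proof -
  show pair: "farey_pair (p1 + p2) (q1 + q2) p2 q2"
    using q1_pos q2_pos det by unfold_locales (simp_all add: algebra_simps)
  show "farey_pair.lower (p1 + p2) (q1 + q2) = mediant"
    by (simp add: farey_pair.lower_def[OF pair] mediant_def)
qed

lemma mediant_minus_lower: "mediant - lower = 1 / (of_int q1 * of_int (q1 + q2))"
  by (rule lower_half.upper_minus_lower)

lemma upper_minus_mediant: "upper - mediant = 1 / (of_int (q1 + q2) * of_int q2)"
  by (rule upper_half.upper_minus_lower)

lemma height_mediant: "height (to_circle mediant) = nat (q1 + q2)"
  by (rule lower_half.height_upper)

lemma mediant_order: "lower < mediant" "mediant < upper" "upper \<le> lower + 1"
proof -
  show "lower < mediant" by (rule lower_half.lower_less_upper)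
  show "mediant < upper" by (rule upper_half.lower_less_upper)
  have "upper - lower \<le> 1 / (1 * 1)"
    unfolding upper_minus_lower using q1_pos q2_pos by (intro divide_left_mono mult_mono) auto
  then show "upper \<le> lower + 1" by simp
qed

lemma to_circle_in_rat_circle:
  "to_circle lower \<in> rat_circle" "to_circle mediant \<in> rat_circle" "to_circle upper \<in> rat_circle"
  unfolding rat_circle_def lower_def mediant_def upper_def by auto

lemma mediant_nonzero: "to_circle mediant \<noteq> 0"
  using height_mediant height_0 q1_pos q2_pos by auto

lemma height_mediant_less_if_between:
  assumes "to_circle x \<in> rat_circle" "lower < x" "x < upper" "x \<noteq> mediant"
  shows "height (to_circle mediant) < height (to_circle x)"
proof -
  obtain c d :: int where cd: "d > 0" "coprime c d" "x = of_int c / of_int d"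
    using Rats_if_to_circle_in_rat_circle[OF assms(1)] by (rule Rats_cases')
  have "q1 + q2 < d"
    using lower_half.sum_denominators_le[of d c] upper_half.sum_denominators_le[of d c]
      assms cd q1_pos q2_pos by (cases "x < mediant") auto
  then show ?thesis using height_to_circle[OF cd(1,2)] cd height_mediant by auto
qed

lemma zero_notin_circle_arc: "0 \<notin> circle_arc lower upper"
proof
  assume "0 \<in> circle_arc lower upper"
  then obtain x where "to_circle x = 0" "lower < x" "x < upper"
    by (auto simp: circle_arc_def)
  moreover have "0 \<in> rat_circle" by (auto simp: rat_circle_def simp flip: to_circle_0)
  ultimately have "height (to_circle mediant) < height 0"
    using height_mediant_less_if_between[of x] mediant_nonzero by auto
  then show False using height_0 height_mediant q1_pos q2_pos by simp
qed

lemma arc_between_lower_mediant: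
  "arc_between (to_circle lower) (to_circle mediant) = circle_arc lower mediant"
  using mediant_order by (intro arc_between_eq_circle_arc) auto

lemma arc_between_mediant_upper:
  "arc_between (to_circle mediant) (to_circle upper) = circle_arc mediant upper"
  using mediant_order by (intro arc_between_eq_circle_arc) auto

lemma left_nbr_mediant: "left_nbr (to_circle mediant) = to_circle lower"
proof (rule left_nbr_eqI)
  show "to_circle lower \<in> farey (height (to_circle mediant))"
    using height_lower height_mediant q2_pos to_circle_in_rat_circle by (auto simp: farey_def)
  show "to_circle lower \<noteq> to_circle mediant"
    using to_circle_eq_imp_eq[of lower mediant] mediant_order by auto
  show "arc_between (to_circle lower) (to_circle mediant)
      \<inter> farey (height (to_circle mediant)) = {}"
    using height_mediant_less_if_between mediant_order
    by (fastforce simp: arc_between_lower_mediant circle_arc_def farey_def)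
qed

lemma right_nbr_mediant: "right_nbr (to_circle mediant) = to_circle upper"
proof (rule right_nbr_eqI)
  show "to_circle upper \<in> farey (height (to_circle mediant))"
    using height_upper height_mediant q1_pos to_circle_in_rat_circle by (auto simp: farey_def)
  show "to_circle upper \<noteq> to_circle mediant"
    using to_circle_eq_imp_eq[of upper mediant] mediant_order by auto
  show "arc_between (to_circle mediant) (to_circle upper)
      \<inter> farey (height (to_circle mediant)) = {}"
    using height_mediant_less_if_between mediant_order
    by (fastforce simp: arc_between_mediant_upper circle_arc_def farey_def)
qed

definition farey_step :: "circle \<Rightarrow> real" where
  "farey_step c = of_int q1 * indicator (circle_arc lower mediant) c
     - of_int q2 * indicator (circle_arc mediant upper) c"

lemma farey_fun_mediant:
  assumes "c \<notin> {to_circle lower, to_circle mediant, to_circle upper}"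
  shows "farey_fun (to_circle mediant) c = farey_step c"
proof -
  \<comment> \<open>Since \<open>h(\<beta>) = h(\<beta>') + h(\<beta>'')\<close>, the sawtooth functions can be grouped into differences.\<close>
  have "farey_fun (to_circle mediant) c
    = of_int q2 * (psi (c - to_circle mediant) - psi (c - to_circle upper))
      - of_int q1 * (psi (c - to_circle lower) - psi (c - to_circle mediant))"
    using mediant_nonzero q1_pos q2_pos
    by (simp add: farey_fun_def left_nbr_mediant right_nbr_mediant
        height_lower height_mediant height_upper algebra_simps)
  also have "\<dots> = of_int q2 * (upper - mediant) - of_int q1 * (mediant - lower) + farey_step c"
    using assms mediant_order by (simp add: psi_diff farey_step_def algebra_simps)
  also have "of_int q2 * (upper - mediant) = of_int q1 * (mediant - lower)"
    unfolding upper_minus_mediant mediant_minus_lower using q1_pos q2_pos by simp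
  finally show ?thesis by simp
qed

lemma borel_measurable_farey_step: "farey_step \<in> borel_measurable haar"
  unfolding farey_step_def[abs_def]
  by (intro borel_measurable_diff borel_measurable_times borel_measurable_const
      borel_measurable_indicator circle_arc_in_sets_haar)

lemma AE_farey_fun_mediant: "AE c in haar. farey_fun (to_circle mediant) c = farey_step c"
proof (rule AE_I')
  have "{to_circle lower} \<union> {to_circle mediant} \<union> {to_circle upper} \<in> null_sets haar"
    by (intro null_sets.Un haar_singleton_null)
  then show "{to_circle lower, to_circle mediant, to_circle upper} \<in> null_sets haar"
    by (simp add: insert_commute)
qed (use farey_fun_mediant in blast)

lemma farey_fun_mediant_constant_on:
  assumes "connected J" "J \<inter> {to_circle lower, to_circle mediant, to_circle upper} = {}"
  shows "farey_fun (to_circle mediant) constant_on J"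
proof -
  have "J \<subseteq> circle_arc lower mediant \<or> J \<inter> circle_arc lower mediant = {}"
    "J \<subseteq> circle_arc mediant upper \<or> J \<inter> circle_arc mediant upper = {}"
    using assms mediant_order by (intro connected_subset_circle_arc_or_disjoint; simp)+
  then have "farey_step x = farey_step y" if "x \<in> J" "y \<in> J" for x y
    using that by (auto simp: farey_step_def indicator_def)
  moreover have "farey_fun (to_circle mediant) x = farey_step x" if "x \<in> J" for x
    using assms(2) that by (intro farey_fun_mediant) blast
  ultimately show ?thesis
    unfolding constant_on_def by metis
qed

lemma farey_step_eq_0:
  assumes "c \<notin> circle_arc lower upper"
  shows "farey_step c = 0"
  using assms mediant_order by (auto simp: farey_step_def circle_arc_def indicator_def)

lemma integral_farey_step: "integral\<^sup>L haar farey_step = 0"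
proof -
  interpret prob_space haar by (rule prob_space_haar)
  have "integral\<^sup>L haar farey_step
    = of_int q1 * measure haar (circle_arc lower mediant)
      - of_int q2 * measure haar (circle_arc mediant upper)"
    unfolding farey_step_def
    by (simp add: circle_arc_in_sets_haar space_haar less_top[symmetric])
  also have "\<dots> = 0"
    using q1_pos q2_pos mediant_order
    by (simp add: measure_haar_circle_arc mediant_minus_lower upper_minus_mediant)
  finally show ?thesis .
qed

lemma set_integral_farey_fun_mediant:
  assumes "A \<in> sets haar"
    and "circle_arc lower upper \<subseteq> A \<or> circle_arc lower upper \<inter> A = {}"
  shows "(LINT c:A|haar. farey_fun (to_circle mediant) c) = 0"
  using assms(2)
proof
  assume subset: "circle_arc lower upper \<subseteq> A"
  have "AE c in haar. indicat_real A c *\<^sub>R farey_fun (to_circle mediant) c = farey_step c"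
    using AE_farey_fun_mediant
    by eventually_elim (use subset farey_step_eq_0 in \<open>auto simp: indicator_def\<close>)
  then have "(LINT c:A|haar. farey_fun (to_circle mediant) c) = integral\<^sup>L haar farey_step"
    unfolding set_lebesgue_integral_def
    using assms(1) integrable_farey_fun borel_measurable_farey_step
    by (intro integral_cong_AE) auto
  then show ?thesis by (simp add: integral_farey_step)
next
  assume disjoint: "circle_arc lower upper \<inter> A = {}"
  have "AE c in haar. indicat_real A c *\<^sub>R farey_fun (to_circle mediant) c = 0"
    using AE_farey_fun_mediant
    by eventually_elim (use disjoint farey_step_eq_0 in \<open>auto simp: indicator_def\<close>)
  then show ?thesis
    unfolding set_lebesgue_integral_def by (rule integral_eq_zero_AE)
qed

end

lemma modular_inverse_exists:
  fixes a q :: int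
  assumes "coprime a q" "q > 1"
  obtains u v where "0 < u" "u < q" "a * u - v * q = 1"
proof -
  obtain s t where "s * a + t * q = 1" using bezout_int[of a q] assms(1) by auto
  moreover have "a * (s mod q) - (- t - a * (s div q)) * q = (s div q * q + s mod q) * a + t * q"
    by (simp only: algebra_simps)
  ultimately have eq: "a * (s mod q) - (- t - a * (s div q)) * q = 1" by simp
  have "s mod q \<noteq> 0"
  proof
    assume "s mod q = 0"
    with eq have "q dvd 1" by (metis diff_0 dvd_minus_iff dvd_triv_right mult_zero_right)
    with \<open>q > 1\<close> show False by auto
  qed
  then have "0 < s mod q" "s mod q < q"
    using \<open>q > 1\<close> by (simp_all add: order_neq_le_trans)
  with eq show ?thesis by (rule that[rotated 2])
qed

lemma rational_is_farey_mediant: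
  assumes "x \<in> \<rat>" "x \<notin> \<int>"
  obtains p1 q1 p2 q2 where "farey_pair p1 q1 p2 q2" "x = farey_pair.mediant p1 q1 p2 q2"
proof -
  obtain a q :: int where aq: "q > 0" "coprime a q" "x = of_int a / of_int q"
    using assms(1) by (rule Rats_cases')
  with assms(2) have "q \<noteq> 1" by auto
  with \<open>q > 0\<close> have "q > 1" by simp
  with \<open>coprime a q\<close> obtain u v where uv: "0 < u" "u < q" "a * u - v * q = 1"
    by (rule modular_inverse_exists)
  have pair: "farey_pair v u (a - v) (q - u)"
    using uv by unfold_locales (simp_all add: algebra_simps)
  then have "x = farey_pair.mediant v u (a - v) (q - u)"
    using aq by (simp add: farey_pair.mediant_def)
  with pair show ?thesis by (rule that)
qed

lemma rat_circle_is_farey_mediant: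
  assumes "c \<in> rat_circle" "c \<noteq> 0"
  obtains p1 q1 p2 q2
    where "farey_pair p1 q1 p2 q2" "c = to_circle (farey_pair.mediant p1 q1 p2 q2)"
proof -
  obtain x where x: "c = to_circle x" "x \<in> \<rat>" using assms(1) by (auto simp: rat_circle_def)
  with \<open>c \<noteq> 0\<close> have "x \<notin> \<int>" by (auto simp: to_circle_eq_iff simp flip: to_circle_0)
  with x(2) obtain p1 q1 p2 q2 where "farey_pair p1 q1 p2 q2"
    and "x = farey_pair.mediant p1 q1 p2 q2"
    by (rule rational_is_farey_mediant)
  with x(1) that show ?thesis by simp
qed

lemma nbrs_in_rat_circle:
  assumes "c \<in> rat_circle" "c \<noteq> 0"
  shows "left_nbr c \<in> rat_circle" "right_nbr c \<in> rat_circle"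
proof -
  obtain p1 q1 p2 q2 where "farey_pair p1 q1 p2 q2"
    and c: "c = to_circle (farey_pair.mediant p1 q1 p2 q2)"
    using assms by (rule rat_circle_is_farey_mediant)
  then interpret farey_pair p1 q1 p2 q2 by simp
  show "left_nbr c \<in> rat_circle" "right_nbr c \<in> rat_circle"
    by (simp_all add: c left_nbr_mediant right_nbr_mediant to_circle_in_rat_circle)
qed

lemma (in farey_pair) nbr_in_circle_arc:
  assumes "c \<in> rat_circle" "c \<in> circle_arc lower upper" "c \<noteq> to_circle mediant"
  shows "left_nbr c \<in> circle_arc lower upper \<or> right_nbr c \<in> circle_arc lower upper"
proof -
  obtain x where x: "c = to_circle x" "lower < x" "x < upper"
    using assms(2) by (auto simp: circle_arc_def)
  have less: "height (to_circle mediant) < height (to_circle x)"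
    using assms x by (intro height_mediant_less_if_between) auto
  have "x \<notin> \<int>"
    using zero_notin_circle_arc assms(2) to_circle_eq_iff[of x 0] by (auto simp: to_circle_0 x(1))
  moreover have "x \<in> \<rat>" using Rats_if_to_circle_in_rat_circle assms(1) x(1) by blast
  ultimately obtain a1 b1 a2 b2 where "farey_pair a1 b1 a2 b2"
    and mediant': "x = farey_pair.mediant a1 b1 a2 b2"
    using rational_is_farey_mediant by blast
  then interpret nbrs: farey_pair a1 b1 a2 b2 by simp
  have "height (to_circle x) < height (to_circle mediant)"
    if "nbrs.lower < mediant" "mediant < nbrs.upper"
    using nbrs.height_mediant_less_if_between[OF to_circle_in_rat_circle(2) that]
      assms(3) x(1) mediant' by metis
  with less have "\<not> (nbrs.lower < mediant \<and> mediant < nbrs.upper)" by fastforce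
  then have "lower < nbrs.lower \<or> nbrs.upper < upper"
    using mediant_order by linarith
  then have "nbrs.lower \<in> {lower<..<upper} \<or> nbrs.upper \<in> {lower<..<upper}"
    using nbrs.mediant_order x mediant' by auto
  then show ?thesis
    using nbrs.left_nbr_mediant nbrs.right_nbr_mediant x mediant' by (auto simp: circle_arc_def)
qed


section \<open>Countable partitions and cells\<close>

lemma sigma_sets_contains_or_disjoint:
  assumes "A \<in> sigma_sets \<Omega> P" "S \<subseteq> \<Omega>" "\<And>G. G \<in> P \<Longrightarrow> S \<subseteq> G \<or> S \<inter> G = {}"
  shows "S \<subseteq> A \<or> S \<inter> A = {}"
  using assms(1) by induction (use assms(2,3) in blast)+

lemma saturated_in_sigma_sets:
  assumes "countable P" "\<Union> P = \<Omega>" "A \<subseteq> \<Omega>" "\<And>G. G \<in> P \<Longrightarrow> G \<subseteq> A \<or> G \<inter> A = {}"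
  shows "A \<in> sigma_sets \<Omega> P"
proof -
  have "A = \<Union> {G \<in> P. G \<subseteq> A}" using assms(2-4) by blast
  also have "\<dots> \<in> sigma_sets \<Omega> P"
    using assms(1) by (intro sigma_sets_UNION) (auto intro: countable_subset)
  finally show ?thesis .
qed

lemma measurable_sigma_if_constant_on:
  assumes "countable P" "\<Union> P = \<Omega>" "f \<in> \<Omega> \<rightarrow> space N" "\<And>G. G \<in> P \<Longrightarrow> f constant_on G"
  shows "f \<in> measurable (sigma \<Omega> P) N"
proof (rule measurableI)
  have P: "P \<subseteq> Pow \<Omega>" using assms(2) by blast
  show "f x \<in> space N" if "x \<in> space (sigma \<Omega> P)" for x
    using that assms(3) by (auto simp: space_measure_of[OF P])
  show "f -` B \<inter> space (sigma \<Omega> P) \<in> sets (sigma \<Omega> P)" for B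
    unfolding sets_measure_of[OF P] space_measure_of[OF P]
  proof (rule saturated_in_sigma_sets[OF assms(1,2)])
    fix G assume "G \<in> P"
    then have "G \<subseteq> \<Omega>" "f constant_on G" using assms(2,4) by auto
    then obtain y where "\<And>x. x \<in> G \<Longrightarrow> f x = y" by (auto simp: constant_on_def)
    with \<open>G \<subseteq> \<Omega>\<close> show "G \<subseteq> f -` B \<inter> \<Omega> \<or> G \<inter> (f -` B \<inter> \<Omega>) = {}"
      by (cases "y \<in> B") auto
  qed simp
qed

definition cells :: "'a::topological_space set \<Rightarrow> 'a set set" where
  "cells F = components (UNIV - F) \<union> (\<lambda>x. {x}) ` F"

lemma Union_cells: "\<Union> (cells F) = UNIV"
proof -
  have "\<Union> (cells F) = (UNIV - F) \<union> F" by (simp add: cells_def Union_Un_distrib)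
  then show ?thesis by blast
qed

lemma connected_subset_cell_or_disjoint:
  assumes "connected S" "S \<inter> F = {}" "G \<in> cells F"
  shows "S \<subseteq> G \<or> S \<inter> G = {}"
proof (cases "G \<in> components (UNIV - F)")
  case True
  with assms(1,2) components_maximal[of G "UNIV - F" S] show ?thesis by blast
next
  case False
  with assms show ?thesis by (auto simp: cells_def)
qed

lemma cell_subset_coarser_cell_or_disjoint:
  assumes "F \<subseteq> F'" "G \<in> cells F'" "H \<in> cells F"
  shows "G \<subseteq> H \<or> G \<inter> H = {}"
proof (cases "G \<in> components (UNIV - F')")
  case True
  then have "connected G" "G \<inter> F = {}"
    using in_components_connected in_components_subset assms(1) by blast+
  with assms(3) show ?thesis by (intro connected_subset_cell_or_disjoint)
next
  case False
  with assms(2) show ?thesis by (auto simp: cells_def)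
qed

lemma open_component_Compl_finite:
  fixes F :: "circle set"
  assumes "finite F" "J \<in> components (UNIV - F)"
  shows "open J"
proof (rule open_circle_component)
  show "open (UNIV - F)" using assms(1) by (intro open_Diff open_UNIV finite_imp_closed)
qed (rule assms(2))

lemma cells_in_borel:
  fixes F :: "circle set"
  assumes "finite F"
  shows "cells F \<subseteq> sets borel"
  using assms open_component_Compl_finite by (auto simp: cells_def)

lemma countable_cells:
  fixes F :: "circle set"
  assumes "finite F"
  shows "countable (cells F)"
proof -
  have "countable (components (UNIV - F))"
    using assms open_component_Compl_finite components_nonoverlap[of _ "UNIV - F"]
    by (intro countable_disjoint_open_subsets) (auto simp: pairwise_def disjnt_def)
  with assms show ?thesis by (simp add: cells_def countable_finite)
qed

lemma sigma_sets_cells_mono: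
  fixes F F' :: "circle set"
  assumes "finite F'" "F \<subseteq> F'"
  shows "sigma_sets UNIV (cells F) \<subseteq> sigma_sets UNIV (cells F')"
proof (rule sigma_sets_mono, rule subsetI)
  fix H assume "H \<in> cells F"
  with assms show "H \<in> sigma_sets UNIV (cells F')"
    by (intro saturated_in_sigma_sets countable_cells Union_cells
        cell_subset_coarser_cell_or_disjoint[of F F']) auto
qed

lemma filt_eq_sigma_cells: "filt \<beta> n = sigma UNIV (cells (\<beta> ` {1..n}))"
proof -
  have "{{\<beta> k} | k. k \<in> {1..n}} = (\<lambda>x. {x}) ` \<beta> ` {1..n}" by auto
  then show ?thesis by (simp add: filt_def cells_def)
qed

lemma sets_filt: "sets (filt \<beta> n) = sigma_sets UNIV (cells (\<beta> ` {1..n}))"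
  by (simp add: filt_eq_sigma_cells)

lemma subalgebra_filt: "subalgebra haar (filt \<beta> n)"
proof -
  have "sets (filt \<beta> n) \<subseteq> sets haar"
    unfolding sets_filt sets_haar
    using sets.sigma_sets_subset[OF cells_in_borel, of "\<beta> ` {1..n}"] by simp
  then show ?thesis by (simp add: subalgebra_def space_haar filt_eq_sigma_cells)
qed

lemma sets_filt_mono: "m \<le> n \<Longrightarrow> sets (filt \<beta> m) \<subseteq> sets (filt \<beta> n)"
  unfolding sets_filt by (intro sigma_sets_cells_mono) auto


section \<open>Admissible enumerations\<close>

lemma admissible_image:
  assumes "admissible \<beta>"
  shows "\<beta> ` {1..} = rat_circle"
  using assms unfolding admissible_def by (blast dest: bij_betw_imp_surj_on)

lemma admissible_eq_iff:
  assumes "admissible \<beta>" "j \<ge> 1" "k \<ge> 1"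
  shows "\<beta> j = \<beta> k \<longleftrightarrow> j = k"
  using assms unfolding admissible_def bij_betw_def by (auto dest: inj_onD)

lemma admissible_eq_0_iff:
  assumes "admissible \<beta>" "k \<ge> 1"
  shows "\<beta> k = 0 \<longleftrightarrow> k = 1"
  using assms admissible_eq_iff[of \<beta> k 1] unfolding admissible_def by auto

lemma admissible_rational_nonzero:
  assumes "admissible \<beta>" "k \<ge> 2"
  shows "\<beta> k \<in> rat_circle" "\<beta> k \<noteq> 0"
  using assms admissible_image[OF assms(1)] admissible_eq_0_iff[OF assms(1), of k] by auto

lemma admissible_nbrs_earlier:
  assumes "admissible \<beta>" "k \<ge> 2"
  shows "left_nbr (\<beta> k) \<in> \<beta> ` {1..<k}" "right_nbr (\<beta> k) \<in> \<beta> ` {1..<k}"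
proof -
  note nbrs_rational = nbrs_in_rat_circle[OF admissible_rational_nonzero[OF assms]]
  obtain i where i: "i \<ge> 1" "\<beta> i = left_nbr (\<beta> k)"
    using nbrs_rational(1) unfolding admissible_image[OF assms(1), symmetric] by auto
  with assms have "i < k" unfolding admissible_def by blast
  with i show "left_nbr (\<beta> k) \<in> \<beta> ` {1..<k}" by (intro image_eqI[of _ _ i]) auto
  obtain j where j: "j \<ge> 1" "\<beta> j = right_nbr (\<beta> k)"
    using nbrs_rational(2) unfolding admissible_image[OF assms(1), symmetric] by auto
  with assms have "j < k" unfolding admissible_def by blast
  with j show "right_nbr (\<beta> k) \<in> \<beta> ` {1..<k}" by (intro image_eqI[of _ _ j]) auto
qed

lemma admissible_farey_mediant:
  assumes "admissible \<beta>" "n \<ge> 2"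
  obtains p1 q1 p2 q2
    where "farey_pair p1 q1 p2 q2" "\<beta> n = to_circle (farey_pair.mediant p1 q1 p2 q2)"
  using admissible_rational_nonzero[OF assms] by (rule rat_circle_is_farey_mediant)

lemma (in farey_pair) mediant_first_in_circle_arc:
  assumes adm: "admissible \<beta>" and n: "n \<ge> 1" "\<beta> n = to_circle mediant"
    and k: "k \<ge> 1" "\<beta> k \<in> circle_arc lower upper"
  shows "n \<le> k"
  using k
proof (induction k rule: less_induct)
  case (less k)
  show ?case
  proof (cases "\<beta> k = to_circle mediant")
    case True
    then show ?thesis using admissible_eq_iff[OF adm n(1) less.prems(1)] n(2) by simp
  next
    case False
    have "\<beta> k \<noteq> 0" using less.prems zero_notin_circle_arc by metis
    then have "k \<ge> 2" using less.prems admissible_eq_0_iff[OF adm, of k] by simp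
    have "left_nbr (\<beta> k) \<in> circle_arc lower upper \<or> right_nbr (\<beta> k) \<in> circle_arc lower upper"
      using less.prems False admissible_rational_nonzero[OF adm \<open>k \<ge> 2\<close>]
      by (intro nbr_in_circle_arc)
    then obtain j where "1 \<le> j" "j < k" "\<beta> j \<in> circle_arc lower upper"
      using admissible_nbrs_earlier[OF adm \<open>k \<ge> 2\<close>] by auto
    with less.IH show ?thesis by fastforce
  qed
qed

lemma borel_measurable_farey_fun_filt:
  assumes "admissible \<beta>" "n \<ge> 1"
  shows "farey_fun (\<beta> n) \<in> borel_measurable (filt \<beta> n)"
  unfolding filt_eq_sigma_cells
proof (rule measurable_sigma_if_constant_on)
  fix G assume G: "G \<in> cells (\<beta> ` {1..n})"
  show "farey_fun (\<beta> n) constant_on G"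
  proof (cases "n \<ge> 2 \<and> G \<in> components (UNIV - \<beta> ` {1..n})")
    case True
    then have "n \<ge> 2" by simp
    with assms(1) obtain p1 q1 p2 q2 where "farey_pair p1 q1 p2 q2"
      and n: "\<beta> n = to_circle (farey_pair.mediant p1 q1 p2 q2)"
      by (rule admissible_farey_mediant)
    then interpret farey_pair p1 q1 p2 q2 by simp
    note nbrs_earlier =
      admissible_nbrs_earlier[OF assms(1), of n, unfolded n left_nbr_mediant right_nbr_mediant]
    have "to_circle lower \<in> \<beta> ` {1..n}" "to_circle upper \<in> \<beta> ` {1..n}"
      using nbrs_earlier True image_mono[of "{1..<n}" "{1..n}" \<beta>] by auto
    moreover have "to_circle mediant \<in> \<beta> ` {1..n}" using assms(2) by (auto simp flip: n)
    moreover have "connected G" "G \<subseteq> UNIV - \<beta> ` {1..n}"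
      using True in_components_connected in_components_subset by blast+
    ultimately show ?thesis
      unfolding n by (intro farey_fun_mediant_constant_on) auto
  next
    case False
    with G assms have "\<beta> n = 0 \<or> is_singleton G"
      using admissible_eq_0_iff[OF assms] by (auto simp: cells_def)
    then show ?thesis
      by (auto simp: constant_on_def farey_fun_def is_singleton_def)
  qed
qed (simp_all add: countable_cells Union_cells)

lemma set_integral_farey_fun:
  assumes "admissible \<beta>" "n \<ge> 1" "A \<in> sets (filt \<beta> n)"
  shows "(LINT x:A|haar. farey_fun (\<beta> (n + 1)) x) = 0"
proof -
  have "n + 1 \<ge> 2" using assms(2) by simp
  with assms(1) obtain p1 q1 p2 q2 where "farey_pair p1 q1 p2 q2"
    and n: "\<beta> (n + 1) = to_circle (farey_pair.mediant p1 q1 p2 q2)"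
    by (rule admissible_farey_mediant)
  then interpret farey_pair p1 q1 p2 q2 by simp
  have disjoint: "circle_arc lower upper \<inter> \<beta> ` {1..n} = {}"
    using mediant_first_in_circle_arc[OF assms(1) _ n] by fastforce
  have "circle_arc lower upper \<subseteq> A \<or> circle_arc lower upper \<inter> A = {}"
  proof (rule sigma_sets_contains_or_disjoint)
    show "A \<in> sigma_sets UNIV (cells (\<beta> ` {1..n}))"
      using assms(3) by (simp only: sets_filt)
    show "circle_arc lower upper \<subseteq> G \<or> circle_arc lower upper \<inter> G = {}"
      if "G \<in> cells (\<beta> ` {1..n})" for G
      using connected_circle_arc disjoint that by (rule connected_subset_cell_or_disjoint)
  qed simp
  moreover have "A \<in> sets haar" using assms(3) subalgebra_filt by (auto simp: subalgebra_def)
  ultimately show ?thesis unfolding n by (intro set_integral_farey_fun_mediant)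
qed

lemma cond_exp_farey_fun:
  assumes "admissible \<beta>" "n \<ge> 1"
  shows "AE x in haar. real_cond_exp haar (filt \<beta> n) (farey_fun (\<beta> (n + 1))) x = 0"
proof -
  interpret prob_space haar by (rule prob_space_haar)
  interpret finite_measure_subalgebra haar "filt \<beta> n"
    by standard (rule subalgebra_filt)
  show ?thesis
  proof (rule real_cond_exp_charact)
    show "(LINT x:A|haar. farey_fun (\<beta> (n + 1)) x) = (LINT x:A|haar. 0)"
      if "A \<in> sets (filt \<beta> n)" for A
      using set_integral_farey_fun[OF assms that] by (simp add: set_lebesgue_integral_def)
  qed (simp_all add: integrable_farey_fun)
qed

theorem theorem7:
  fixes \<beta> :: "nat \<Rightarrow> circle"
  assumes "admissible \<beta>"
  shows "(\<forall>n\<ge>1. subalgebra haar (filt \<beta> n)) \<and>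
         (\<forall>n\<ge>1. integrable haar (farey_fun (\<beta> n))) \<and>
         (\<forall>n\<ge>1. farey_fun (\<beta> n) \<in> borel_measurable (filt \<beta> n)) \<and>
         (\<forall>n\<ge>1. sets (filt \<beta> n) \<subseteq> sets (filt \<beta> (n + 1))) \<and>
         (\<forall>n\<ge>1. AE x in haar. real_cond_exp haar (filt \<beta> n) (farey_fun (\<beta> (n + 1))) x = 0) \<and>
         (\<forall>n\<ge>1. \<forall>J \<in> components (UNIV - \<beta> ` {1..n}).
            (LINT x:J|haar. farey_fun (\<beta> (n + 1)) x) = 0)"
proof (intro conjI allI impI ballI)
  fix n :: nat and J assume "n \<ge> 1" "J \<in> components (UNIV - \<beta> ` {1..n})"
  then show "(LINT x:J|haar. farey_fun (\<beta> (n + 1)) x) = 0"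
    by (intro set_integral_farey_fun[OF assms]) (auto simp: sets_filt cells_def)
qed (use assms subalgebra_filt integrable_farey_fun borel_measurable_farey_fun_filt
      sets_filt_mono[of _ "_ + 1"] cond_exp_farey_fun in auto)

end
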